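(* Let $A,M,B,P,R$ be as in the context, and suppose that $\|I-M^{-1}A\|_B<1$, that $\Pi_A$ is a $B$-orthogonal projection with $\Pi_A\ne0$ and $\Pi_A\ne I_n$, and that $I-\widehat M^{-1}B$ is nonsingular. Then $$\|E_+^{1,1}\|_B=\|E_+^{1,0}\|_B^2=\|E_+^{0,1}\|_B^2=1-\lambda_{min}^+\bigl(\widehat M^{-1}B(I-\Pi_A)\bigr)$$ with $\lambda_{min}^+(\widehat M^{-1}B(I-\Pi_A))\in(0,1)$. Additionally, $\sigma(\widehat M^{-1}B(I-\Pi_A))\subseteq[0,1)$.
   Context: $A\in\mathbb{C}^{n\times n}$ is nonsingular, $M^{-1}\in\mathbb{C}^{n\times n}$ is nonsingular, and $B\in\mathbb{C}^{n\times n}$ is Hermitian positive definite (HPD). $\|x\|_B=\sqrt{x^HBx}$ and $\|C\|_B=\sup_{x\ne0}\|Cx\|_B/\|x\|_B$. The $B$-adjoint of $C\in\mathbb{C}^{n\times n}$ is $C^+=B^{-1}C^HB$; $C$ is $B$-orthogonal if $C^+=C$. $\sigma$ denotes the spectrum; for a matrix with real eigenvalues, $\lambda_{min}^+$ denotes its smallest positive eigenvalue. $P,R\in\mathbb{C}^{n\times n_c}$, $n_c<n$, are such that $R^HAP$ is nonsingular, and $\Pi_A=P(R^HAP)^{-1}R^HA$ (a projection). The error propagation matrices are, for $\nu_1,\nu_2\in\mathbb{N}_0$, $$E_+^{\nu_1,\nu_2}=(I-(M^{-1}A)^+)^{\nu_2}(I-\Pi_A)(I-M^{-1}A)^{\nu_1}.$$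 The matrix $\widehat M^{-1}$ is defined by $\widehat M^{-1}=M^{-1}AB^{-1}+B^{-1}A^HM^{-H}-M^{-1}AB^{-1}A^HM^{-H}$, so that $I-\widehat M^{-1}B=(I-M^{-1}A)(I-M^{-1}A)^+$. *)

theory Defs
  imports "HOL-Analysis.Analysis"
begin

definition adjoint_mat :: "complex ^ 'n ^ 'm \<Rightarrow> complex ^ 'm ^ 'n"  ("(_\<^sup>H)" [1000] 1000)
  where "C\<^sup>H = (\<chi> i j. cnj (C $ j $ i))"

text \<open>The product \<open>*\<close> on the type \<open>complex ^ 'n ^ 'n\<close> is entrywise, so \<open>^\<close> is not the
  matrix power.\<close>

primrec mat_pow :: "complex ^ 'n ^ 'n \<Rightarrow> nat \<Rightarrow> complex ^ 'n ^ 'n"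
  where
    "mat_pow C 0 = mat 1"
  | "mat_pow C (Suc k) = C ** mat_pow C k"

definition qform :: "complex ^ 'n ^ 'n \<Rightarrow> complex ^ 'n \<Rightarrow> complex"
  where "qform B x = (\<Sum>i\<in>UNIV. cnj (x $ i) * (B *v x) $ i)"

text \<open>For a Hermitian matrix \<open>B\<close> the value \<open>x\<^sup>H B x\<close> is real, so taking \<open>Re\<close> in the next two
  definitions loses nothing.\<close>

definition hpd :: "complex ^ 'n ^ 'n \<Rightarrow> bool"
  where "hpd B \<longleftrightarrow> B\<^sup>H = B \<and> (\<forall>x. x \<noteq> 0 \<longrightarrow> 0 < Re (qform B x))"

definition bnorm :: "complex ^ 'n ^ 'n \<Rightarrow> complex ^ 'n \<Rightarrow> real"
  where "bnorm B x = sqrt (Re (qform B x))"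

definition mat_bnorm :: "complex ^ 'n ^ 'n \<Rightarrow> complex ^ 'n ^ 'n \<Rightarrow> real"
  where "mat_bnorm B C = (SUP x\<in>{x. x \<noteq> 0}. bnorm B (C *v x) / bnorm B x)"

definition badjoint :: "complex ^ 'n ^ 'n \<Rightarrow> complex ^ 'n ^ 'n \<Rightarrow> complex ^ 'n ^ 'n"
  where "badjoint B C = matrix_inv B ** C\<^sup>H ** B"

definition b_orthogonal :: "complex ^ 'n ^ 'n \<Rightarrow> complex ^ 'n ^ 'n \<Rightarrow> bool"
  where "b_orthogonal B C \<longleftrightarrow> badjoint B C = C"

definition spectrum :: "complex ^ 'n ^ 'n \<Rightarrow> complex set"
  where "spectrum C = {l. \<exists>v. v \<noteq> 0 \<and> C *v v = l *s v}"

text \<open>The smallest positive real eigenvalue, intended for a matrix that has only real eigenvalues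
  and at least one positive one; otherwise \<^const>\<open>Least\<close> may be unspecified.\<close>

definition lambda_min_pos :: "complex ^ 'n ^ 'n \<Rightarrow> real"
  where "lambda_min_pos C = (LEAST r. 0 < r \<and> complex_of_real r \<in> spectrum C)"

definition coarse_proj ::
    "complex ^ 'n ^ 'n \<Rightarrow> complex ^ 'c ^ 'n \<Rightarrow> complex ^ 'c ^ 'n \<Rightarrow> complex ^ 'n ^ 'n"
  where "coarse_proj A P R = P ** matrix_inv (R\<^sup>H ** A ** P) ** R\<^sup>H ** A"

definition error_prop ::
    "complex ^ 'n ^ 'n \<Rightarrow> complex ^ 'n ^ 'n \<Rightarrow> complex ^ 'n ^ 'n \<Rightarrow>
     complex ^ 'c ^ 'n \<Rightarrow> complex ^ 'c ^ 'n \<Rightarrow> nat \<Rightarrow> nat \<Rightarrow> complex ^ 'n ^ 'n"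
  where "error_prop A M B P R \<nu>1 \<nu>2 =
    mat_pow (mat 1 - badjoint B (matrix_inv M ** A)) \<nu>2
      ** (mat 1 - coarse_proj A P R)
      ** mat_pow (mat 1 - matrix_inv M ** A) \<nu>1"

text \<open>The matrix written as the inverse of \<open>M\<close>-hat is defined directly by a formula; its
  nonsingularity is not part of the definition, so no \<^const>\<open>matrix_inv\<close> is taken. It satisfies
  \<open>I - Mhat_inv A M B ** B = G ** badjoint B G\<close> for \<open>G = I - matrix_inv M ** A\<close> and
  \<open>B\<close> nonsingular.\<close>

definition Mhat_inv ::
    "complex ^ 'n ^ 'n \<Rightarrow> complex ^ 'n ^ 'n \<Rightarrow> complex ^ 'n ^ 'n \<Rightarrow> complex ^ 'n ^ 'n"
  where "Mhat_inv A M B =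
    matrix_inv M ** A ** matrix_inv B
      + matrix_inv B ** A\<^sup>H ** (matrix_inv M)\<^sup>H
      - matrix_inv M ** A ** matrix_inv B ** A\<^sup>H ** (matrix_inv M)\<^sup>H"

end

theory Submission
  imports Defs
begin

text \<open>Write \<open>\<langle>x, y\<rangle> = x\<^sup>H B y\<close>, \<open>C\<^sup>+\<close> for the \<open>B\<close>-adjoint, \<open>G = I - M\<^sup>-\<^sup>1 A\<close>, \<open>Q = I - \<Pi>\<^sub>A\<close>
  and \<open>X = I - G G\<^sup>+\<close>, which is \<open>B\<close> multiplied on the left by the inverse of \<open>M\<close>-hat
  (lemma \<open>Mhat_inv_smoother\<close>). Since \<open>Q = Q\<^sup>+ = Q\<^sup>2\<close>, the three error propagation matrices are
  \<open>Q G\<close>, \<open>G\<^sup>+ Q = (Q G)\<^sup>+\<close> and \<open>G\<^sup>+ Q G = (Q G)\<^sup>+ (Q G)\<close>. The equalities between their norms are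
  therefore the Hilbert space identities \<open>\<parallel>C\<^sup>+\<parallel> = \<parallel>C\<parallel>\<close> and \<open>\<parallel>C\<^sup>+ C\<parallel> = \<parallel>C\<parallel>\<^sup>2\<close>
  (\<open>mat_bnorm_badjoint\<close> and \<open>mat_bnorm_badjoint_mult_self\<close>).

  For the eigenvalue, \<open>\<parallel>G\<^sup>+ w\<parallel>\<^sup>2 = \<langle>w, w\<rangle> - \<langle>w, X w\<rangle>\<close> gives \<open>\<parallel>G\<^sup>+ Q\<parallel>\<^sup>2 = 1 - m\<close>, where \<open>m\<close> is the
  minimum of the Rayleigh quotient \<open>\<langle>w, X w\<rangle> / \<langle>w, w\<rangle>\<close> over the range of \<open>Q\<close>. A minimiser is an
  eigenvector of the compression \<open>Q X Q\<close> with eigenvalue \<open>m\<close>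
  (\<open>Rayleigh_minimizer_eigenvector\<close>), and \<open>X Q\<close> has the same nonzero eigenvalues as \<open>Q X Q\<close> on the
  range of \<open>Q\<close> (\<open>spectrum_mult_projection\<close>). Every such eigenvalue is itself a Rayleigh
  quotient, hence real and at least \<open>m\<close>. Finally \<open>\<parallel>G\<parallel> < 1\<close> makes all these quotients positive,
  and the nonsingularity of \<open>G G\<^sup>+\<close> makes them smaller than \<open>1\<close>.\<close>

section \<open>Matrix algebra and sesquilinear forms\<close>

definition bform :: "complex ^ 'n ^ 'n \<Rightarrow> complex ^ 'n \<Rightarrow> complex ^ 'n \<Rightarrow> complex"
  where "bform B x y = (\<Sum>i\<in>UNIV. cnj (x $ i) * (B *v y) $ i)"

lemma qform_eq_bform: "qform B x = bform B x x"
  by (simp add: qform_def bform_def)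

text \<open>Compactness arguments live in the underlying real vector space, eigenvalues in the complex
  one; this identifies the two scalar multiplications for real scalars.\<close>

lemma scaleR_eq_smult: "r *\<^sub>R x = of_real r *s (x :: complex ^ 'n)"
  by (simp only: vec_eq_iff vector_scaleR_component vector_smult_component)
     (simp add: scaleR_conv_of_real)

lemma bform_linear_right:
  "bform B x (y + z) = bform B x y + bform B x z"
  "bform B x (y - z) = bform B x y - bform B x z"
  "bform B x (c *s y) = c * bform B x y"
  "bform B x (r *\<^sub>R y) = of_real r * bform B x y"
  "bform B x 0 = 0"
  by (simp_all add: bform_def matrix_vector_right_distrib matrix_vector_mult_diff_distrib
      vector_scalar_commute scaleR_eq_smult
      algebra_simps sum.distrib sum_subtractf sum_distrib_left)

lemma bform_linear_left:
  "bform B (y + z) x = bform B y x + bform B z x"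
  "bform B (y - z) x = bform B y x - bform B z x"
  "bform B (c *s y) x = cnj c * bform B y x"
  "bform B (r *\<^sub>R y) x = of_real r * bform B y x"
  "bform B 0 x = 0"
  by (simp_all add: bform_def scaleR_eq_smult
      algebra_simps sum.distrib sum_subtractf sum_distrib_left)

lemma adjoint_mat_moves:
  "(\<Sum>i\<in>UNIV. cnj ((C *v x) $ i) * y $ i) = (\<Sum>j\<in>UNIV. cnj (x $ j) * (C\<^sup>H *v y) $ j)"
proof -
  have "(\<Sum>i\<in>UNIV. cnj ((C *v x) $ i) * y $ i) = (\<Sum>i\<in>UNIV. \<Sum>j\<in>UNIV. cnj (x $ j) * (cnj (C $ i $ j) * y $ i))"
    by (simp add: matrix_vector_mult_def sum_distrib_left mult_ac)
  also have "\<dots> = (\<Sum>j\<in>UNIV. \<Sum>i\<in>UNIV. cnj (x $ j) * (cnj (C $ i $ j) * y $ i))"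
    by (rule sum.swap)
  also have "\<dots> = (\<Sum>j\<in>UNIV. cnj (x $ j) * (C\<^sup>H *v y) $ j)"
    by (simp add: matrix_vector_mult_def adjoint_mat_def sum_distrib_left)
  finally show ?thesis .
qed

lemma adjoint_mat_mult: "(C ** D)\<^sup>H = D\<^sup>H ** C\<^sup>H"
  by (simp add: adjoint_mat_def matrix_matrix_mult_def vec_eq_iff mult.commute)

lemma adjoint_mat_diff: "(C - D)\<^sup>H = C\<^sup>H - D\<^sup>H"
  by (simp add: adjoint_mat_def vec_eq_iff)

lemma adjoint_mat_one [simp]: "(mat 1)\<^sup>H = mat 1"
  by (auto simp: adjoint_mat_def vec_eq_iff mat_def)

lemma matrix_add_rdistrib: "((A::'a::semiring_1^'m^'n) + B) ** C = A ** C + B ** C"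
  by (simp add: matrix_matrix_mult_def vec_eq_iff distrib_right sum.distrib)

lemma matrix_sub_ldistrib: "(A::'a::ring_1^'m^'n) ** (B - C) = A ** B - A ** C"
  by (simp add: matrix_matrix_mult_def vec_eq_iff right_diff_distrib sum_subtractf)

lemma matrix_sub_rdistrib: "((A::'a::ring_1^'m^'n) - B) ** C = A ** C - B ** C"
  by (simp add: matrix_matrix_mult_def vec_eq_iff left_diff_distrib sum_subtractf)

lemma mat_scalar_mult: "mat c *v x = c *s (x :: 'a::comm_semiring_1 ^ 'n)"
  by (simp add: vec_eq_iff matrix_vector_mult_def mat_def if_distrib if_distribR cong: if_cong)

lemma invertible_kernel_zero:
  fixes C :: "'a::field ^ 'n ^ 'n"
  assumes "invertible C" "C *v x = 0"
  shows "x = 0"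
  using assms invertible_left_inverse matrix_left_invertible_ker by blast

lemma matrix_inv_inverts:
  fixes C :: "'a::field ^ 'n ^ 'n"
  assumes "invertible C"
  shows "C ** matrix_inv C = mat 1" "matrix_inv C ** C = mat 1"
proof -
  have "C ** matrix_inv C = mat 1 \<and> matrix_inv C ** C = mat 1"
    using assms unfolding matrix_inv_def invertible_def by (rule someI_ex)
  then show "C ** matrix_inv C = mat 1" "matrix_inv C ** C = mat 1" by auto
qed

section \<open>Two facts from real analysis\<close>

text \<open>Scaling brings every nonzero point of the cone to the unit sphere without changing the value,
  and the part of the sphere in the cone is compact. Rayleigh quotients and the quotients in the
  definition of an operator norm are of this kind.\<close>

lemma homogeneous_attains_inf:
  fixes f :: "'a::euclidean_space \<Rightarrow> real"
  assumes "closed S" "x0 \<in> S" "x0 \<noteq> 0"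
    and cone: "\<And>c x. x \<in> S \<Longrightarrow> c *\<^sub>R x \<in> S"
    and cont: "continuous_on {x. x \<noteq> 0} f"
    and homog: "\<And>c x. c \<noteq> 0 \<Longrightarrow> x \<noteq> 0 \<Longrightarrow> f (c *\<^sub>R x) = f x"
  obtains v where "v \<in> S" "v \<noteq> 0" "\<And>x. x \<in> S \<Longrightarrow> x \<noteq> 0 \<Longrightarrow> f v \<le> f x"
proof -
  let ?K = "sphere 0 1 \<inter> S"
  have unit: "(1 / norm x) *\<^sub>R x \<in> ?K" if "x \<in> S" "x \<noteq> 0" for x
    using that cone by simp
  have "compact ?K"
    using assms(1) by (simp add: compact_Int_closed)
  moreover have "?K \<noteq> {}"
    using unit assms(2,3) by blast
  moreover have "continuous_on ?K f"
    by (rule continuous_on_subset[OF cont]) auto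
  ultimately obtain v where v: "v \<in> ?K" "\<And>y. y \<in> ?K \<Longrightarrow> f v \<le> f y"
    using continuous_attains_inf by metis
  show ?thesis
  proof (rule that)
    show "v \<in> S" "v \<noteq> 0"
      using v(1) by auto
    show "f v \<le> f x" if "x \<in> S" "x \<noteq> 0" for x
      using v(2)[OF unit[OF that]] homog[of "1 / norm x" x] that by simp
  qed
qed

text \<open>For \<open>a > 0\<close> evaluate at the vertex \<open>t = - b / a\<close>.\<close>

lemma nonneg_quadratic_discriminant:
  fixes a b c :: real
  assumes "0 \<le> a" and nonneg: "\<And>t. 0 \<le> a * t\<^sup>2 + 2 * b * t + c"
  shows "b\<^sup>2 \<le> a * c"
proof (cases "a = 0")
  case True
  have "b = 0"
  proof (rule ccontr)
    assume "b \<noteq> 0"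
    \<comment> \<open>at this point the affine function takes the value -1\<close>
    then show False
      using nonneg[of "- (c + 1) / (2 * b)"] True by simp
  qed
  then show ?thesis using True by simp
next
  case False
  then have a: "0 < a"
    using assms(1) by simp
  have "0 \<le> a * (- b / a)\<^sup>2 + 2 * b * (- b / a) + c"
    by (rule nonneg)
  also have "\<dots> = (a * c - b\<^sup>2) / a"
    using a by (simp add: power2_eq_square field_simps)
  finally show ?thesis
    using a by (simp add: zero_le_divide_iff)
qed

section \<open>The B-inner product and B-adjoints\<close>

context
  fixes B :: "complex ^ 'n ^ 'n"
  assumes B: "hpd B"
begin

lemma bform_hermitian: "bform B x y = cnj (bform B y x)"
proof -
  have "B\<^sup>H = B" using B by (simp add: hpd_def)
  then have "bform B x y = (\<Sum>i\<in>UNIV. cnj ((B *v x) $ i) * y $ i)"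
    using adjoint_mat_moves[of B x y] by (simp add: bform_def)
  also have "\<dots> = cnj (bform B y x)"
    by (simp add: bform_def mult.commute)
  finally show ?thesis .
qed

lemma bform_pos: "x \<noteq> 0 \<Longrightarrow> 0 < Re (bform B x x)"
  using B by (simp add: hpd_def qform_eq_bform)

lemma bform_nonneg: "0 \<le> Re (bform B x x)"
  using bform_pos[of x] by (cases "x = 0") (auto simp: bform_linear_right)

lemma bform_self_real: "bform B x x = of_real (Re (bform B x x))"
  using bform_hermitian[of x x] by (simp add: complex_eq_iff)

lemma bform_self_eq_0: "Re (bform B x x) = 0 \<Longrightarrow> x = 0"
  using bform_pos[of x] by fastforce

lemma bnorm_sq: "(bnorm B x)\<^sup>2 = Re (bform B x x)"
  using bform_nonneg[of x] by (simp add: bnorm_def qform_eq_bform)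

lemma bnorm_nonneg: "0 \<le> bnorm B x"
  using bform_nonneg[of x] by (simp add: bnorm_def qform_eq_bform)

lemma bnorm_pos: "x \<noteq> 0 \<Longrightarrow> 0 < bnorm B x"
  using bform_pos[of x] by (simp add: bnorm_def qform_eq_bform)

lemma bnorm_zero [simp]: "bnorm B 0 = 0"
  by (simp add: bnorm_def qform_eq_bform bform_linear_right)

lemma bnorm_scaleR: "bnorm B (c *\<^sub>R x) = \<bar>c\<bar> * bnorm B x"
  by (simp add: bnorm_def qform_eq_bform bform_linear_right bform_linear_left
      flip: mult.assoc power2_eq_square) (simp add: real_sqrt_mult flip: power2_eq_square)

lemma hpd_invertible: "invertible B"
proof -
  have "x = 0" if "B *v x = 0" for x
    by (rule bform_self_eq_0) (simp add: bform_def that)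
  then show ?thesis
    using invertible_left_inverse matrix_left_invertible_ker by blast
qed

lemma bform_badjoint_right: "bform B x (badjoint B C *v y) = bform B (C *v x) y"
proof -
  have "B ** badjoint B C = C\<^sup>H ** B"
    by (simp add: badjoint_def matrix_mul_assoc matrix_inv_inverts[OF hpd_invertible])
  then have "B *v (badjoint B C *v y) = C\<^sup>H *v (B *v y)"
    by (simp add: matrix_vector_mul_assoc)
  then show ?thesis
    by (simp add: bform_def adjoint_mat_moves)
qed

lemma bform_badjoint_left: "bform B (badjoint B C *v x) y = bform B x (C *v y)"
  using bform_badjoint_right[of y C x] bform_hermitian by metis

lemma badjoint_mult: "badjoint B (C ** D) = badjoint B D ** badjoint B C"
proof -
  have "badjoint B D ** badjoint B C = matrix_inv B ** D\<^sup>H ** (B ** matrix_inv B) ** C\<^sup>H ** B"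
    by (simp add: badjoint_def matrix_mul_assoc)
  then show ?thesis
    by (simp add: matrix_inv_inverts[OF hpd_invertible] badjoint_def adjoint_mat_mult matrix_mul_assoc)
qed

lemma badjoint_diff: "badjoint B (C - D) = badjoint B C - badjoint B D"
  by (simp add: badjoint_def adjoint_mat_diff matrix_sub_ldistrib matrix_sub_rdistrib)

lemma badjoint_one: "badjoint B (mat 1) = mat 1"
  by (simp add: badjoint_def matrix_inv_inverts[OF hpd_invertible])

text \<open>The defining identity of an adjoint determines it because the form is nondegenerate.\<close>

lemma badjoint_eqI:
  assumes "\<And>x y. bform B (D *v x) y = bform B x (C *v y)"
  shows "badjoint B C = D"
proof -
  have "badjoint B C *v x = D *v x" for x
  proof -
    let ?d = "badjoint B C *v x - D *v x"
    have "bform B ?d ?d = 0"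
      by (simp only: bform_linear_left bform_badjoint_left assms) simp
    then show ?thesis
      using bform_self_eq_0[of ?d] by simp
  qed
  then show ?thesis
    by (simp add: matrix_eq)
qed

lemma badjoint_badjoint: "badjoint B (badjoint B C) = C"
  by (rule badjoint_eqI) (simp add: bform_badjoint_right)

text \<open>The quadratic polynomial \<open>t \<mapsto> \<langle>x + t y, H (x + t y)\<rangle>\<close> is nonnegative. Allowing \<open>H\<close> to be only
  semidefinite serves two purposes: \<open>H = I\<close> is the usual inequality, and a singular \<open>H\<close> gives
  \<open>semidefinite_isotropic_in_kernel\<close>, which replaces a Lagrange multiplier argument.\<close>

lemma semidefinite_Cauchy_Schwarz:
  assumes H: "b_orthogonal B H" and psd: "\<And>x. 0 \<le> Re (bform B x (H *v x))"
  shows "(Re (bform B x (H *v y)))\<^sup>2 \<le> Re (bform B x (H *v x)) * Re (bform B y (H *v y))"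
proof -
  have "bform B y (H *v x) = cnj (bform B x (H *v y))"
    using bform_badjoint_left[of H y x] H bform_hermitian[of "H *v y" x]
    by (simp add: b_orthogonal_def)
  then have sym: "Re (bform B y (H *v x)) = Re (bform B x (H *v y))"
    by simp
  have "0 \<le> Re (bform B y (H *v y)) * t\<^sup>2 + 2 * Re (bform B x (H *v y)) * t + Re (bform B x (H *v x))"
    for t
  proof -
    have "Re (bform B (x + t *\<^sub>R y) (H *v (x + t *\<^sub>R y)))
      = Re (bform B y (H *v y)) * t\<^sup>2 + 2 * Re (bform B x (H *v y)) * t + Re (bform B x (H *v x))"
      by (simp add: matrix_vector_right_distrib linear_cmul[OF matrix_vector_mul_linear]
          bform_linear_left bform_linear_right sym power2_eq_square algebra_simps)
    then show ?thesis using psd[of "x + t *\<^sub>R y"] by simp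
  qed
  from nonneg_quadratic_discriminant[OF psd this] show ?thesis
    by (simp add: mult.commute)
qed

text \<open>Apply the inequality to the pair \<open>H v\<close>, \<open>v\<close>.\<close>

lemma semidefinite_isotropic_in_kernel:
  assumes "b_orthogonal B H" "\<And>x. 0 \<le> Re (bform B x (H *v x))"
    and "Re (bform B v (H *v v)) = 0"
  shows "H *v v = 0"
proof (rule bform_self_eq_0)
  show "Re (bform B (H *v v) (H *v v)) = 0"
    using semidefinite_Cauchy_Schwarz[OF assms(1,2), of "H *v v" v] assms(3) by simp
qed

lemma bform_Cauchy_Schwarz: "Re (bform B x y) \<le> bnorm B x * bnorm B y"
proof (rule power2_le_imp_le)
  show "(Re (bform B x y))\<^sup>2 \<le> (bnorm B x * bnorm B y)\<^sup>2"
    using semidefinite_Cauchy_Schwarz[of "mat 1" x y]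
    by (simp add: b_orthogonal_def badjoint_one bform_nonneg power_mult_distrib bnorm_sq)
  show "0 \<le> bnorm B x * bnorm B y"
    by (simp add: bnorm_nonneg)
qed

section \<open>The operator B-norm\<close>

lemma continuous_on_bform:
  "continuous_on S (\<lambda>x. bform B (C *v x) (D *v x))"
  unfolding bform_def matrix_vector_mult_def
  by (intro continuous_intros)

text \<open>The supremum that defines the operator norm bounds its quotients only if it is taken over a set
  that is bounded above, which is so because the quotient attains its maximum.\<close>

lemma bnorm_mult_le: "bnorm B (C *v x) \<le> mat_bnorm B C * bnorm B x"
proof (cases "x = 0")
  case False
  \<comment> \<open>the sign turns the maximum into a minimum\<close>
  let ?f = "\<lambda>x. - (bnorm B (C *v x) / bnorm B x)"
  have cont: "continuous_on {x. x \<noteq> 0} ?f"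
    unfolding bnorm_def qform_eq_bform
    using continuous_on_bform[where C = C and D = C]
      continuous_on_bform[where C = "mat 1" and D = "mat 1"]
    by (intro continuous_intros) (auto dest: bform_self_eq_0)
  have homog: "?f (c *\<^sub>R x) = ?f x" if "c \<noteq> 0" "x \<noteq> 0" for c x
    using that by (simp add: linear_cmul[OF matrix_vector_mul_linear] bnorm_scaleR)
  obtain v where "\<And>x. x \<noteq> 0 \<Longrightarrow> ?f v \<le> ?f x"
    using homogeneous_attains_inf[of UNIV x ?f, OF closed_UNIV UNIV_I False UNIV_I cont homog]
    by (metis UNIV_I)
  then have "bdd_above ((\<lambda>x. bnorm B (C *v x) / bnorm B x) ` {x. x \<noteq> 0})"
    by (intro bdd_aboveI2[of _ _ "- ?f v"]) auto
  then have "bnorm B (C *v x) / bnorm B x \<le> mat_bnorm B C"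
    unfolding mat_bnorm_def using False by (intro cSUP_upper) auto
  then show ?thesis
    using bnorm_pos[OF False] by (simp add: field_simps)
qed simp

lemma mat_bnorm_le:
  assumes "\<And>x. bnorm B (C *v x) \<le> k * bnorm B x"
  shows "mat_bnorm B C \<le> k"
  unfolding mat_bnorm_def
proof (rule cSUP_least)
  have "axis undefined 1 \<in> {x :: complex ^ 'n. x \<noteq> 0}"
    by (simp add: axis_eq_0_iff)
  then show "{x :: complex ^ 'n. x \<noteq> 0} \<noteq> {}" by blast
  show "bnorm B (C *v x) / bnorm B x \<le> k" if "x \<in> {x. x \<noteq> 0}" for x
    using assms[of x] bnorm_pos[of x] that by (simp add: field_simps)
qed

lemma mat_bnorm_nonneg: "0 \<le> mat_bnorm B C"
proof -
  have "0 < bnorm B (axis undefined 1)"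
    by (rule bnorm_pos) (simp add: axis_eq_0_iff)
  moreover have "0 \<le> mat_bnorm B C * bnorm B (axis undefined 1)"
    using bnorm_mult_le bnorm_nonneg order_trans by blast
  ultimately show ?thesis
    by (simp add: zero_le_mult_iff)
qed

lemma mat_bnorm_mult_le: "mat_bnorm B (C ** D) \<le> mat_bnorm B C * mat_bnorm B D"
proof (rule mat_bnorm_le)
  fix x
  have "bnorm B ((C ** D) *v x) \<le> mat_bnorm B C * bnorm B (D *v x)"
    using bnorm_mult_le[of C "D *v x"] by (simp add: matrix_vector_mul_assoc)
  also have "\<dots> \<le> mat_bnorm B C * (mat_bnorm B D * bnorm B x)"
    by (intro mult_left_mono bnorm_mult_le mat_bnorm_nonneg)
  finally show "bnorm B ((C ** D) *v x) \<le> mat_bnorm B C * mat_bnorm B D * bnorm B x"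
    by (simp add: mult.assoc)
qed

text \<open>Estimates of \<open>\<parallel>y\<parallel>\<^sup>2\<close> by the Cauchy-Schwarz inequality leave a factor \<open>\<parallel>y\<parallel>\<close>
  to be cancelled, which may vanish.\<close>

lemma bnorm_le_of_sq:
  assumes "(bnorm B y)\<^sup>2 \<le> k * bnorm B y" "0 \<le> k"
  shows "bnorm B y \<le> k"
  using assms bnorm_nonneg[of y] by (cases "bnorm B y = 0") (auto simp: power2_eq_square)

text \<open>\<open>\<parallel>C\<^sup>+ x\<parallel>\<^sup>2 = \<langle>x, C C\<^sup>+ x\<rangle> \<le> \<parallel>x\<parallel> \<parallel>C\<parallel> \<parallel>C\<^sup>+ x\<parallel>\<close> gives one inequality; as the adjoint is an
  involution, it gives the other one too.\<close>

lemma mat_bnorm_badjoint: "mat_bnorm B (badjoint B C) = mat_bnorm B C"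
proof -
  have le: "mat_bnorm B (badjoint B C) \<le> mat_bnorm B C" for C
  proof (rule mat_bnorm_le, rule bnorm_le_of_sq)
    fix x
    let ?y = "badjoint B C *v x"
    have "(bnorm B ?y)\<^sup>2 = Re (bform B x (C *v ?y))"
      by (simp add: bnorm_sq bform_badjoint_left)
    also have "\<dots> \<le> bnorm B x * bnorm B (C *v ?y)"
      by (rule bform_Cauchy_Schwarz)
    also have "\<dots> \<le> bnorm B x * (mat_bnorm B C * bnorm B ?y)"
      by (intro mult_left_mono bnorm_mult_le bnorm_nonneg)
    finally show "(bnorm B ?y)\<^sup>2 \<le> mat_bnorm B C * bnorm B x * bnorm B ?y"
      by (simp add: mult_ac)
    show "0 \<le> mat_bnorm B C * bnorm B x"
      by (simp add: mat_bnorm_nonneg bnorm_nonneg)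
  qed
  show ?thesis
    using le[of C] le[of "badjoint B C"] by (simp add: badjoint_badjoint)
qed

text \<open>The lower bound on the left-hand side comes from \<open>\<parallel>C x\<parallel>\<^sup>2 = \<langle>x, C\<^sup>+ C x\<rangle> \<le> \<parallel>C\<^sup>+ C\<parallel> \<parallel>x\<parallel>\<^sup>2\<close>, the
  upper one from submultiplicativity.\<close>

lemma mat_bnorm_badjoint_mult_self: "mat_bnorm B (badjoint B C ** C) = (mat_bnorm B C)\<^sup>2"
proof (rule antisym)
  show "mat_bnorm B (badjoint B C ** C) \<le> (mat_bnorm B C)\<^sup>2"
    using mat_bnorm_mult_le[of "badjoint B C" C] by (simp add: mat_bnorm_badjoint power2_eq_square)
  let ?N = "mat_bnorm B (badjoint B C ** C)"
  have "mat_bnorm B C \<le> sqrt ?N"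
  proof (rule mat_bnorm_le)
    fix x
    have "(bnorm B (C *v x))\<^sup>2 = Re (bform B x ((badjoint B C ** C) *v x))"
      by (simp add: bnorm_sq bform_badjoint_right flip: matrix_vector_mul_assoc)
    also have "\<dots> \<le> bnorm B x * bnorm B ((badjoint B C ** C) *v x)"
      by (rule bform_Cauchy_Schwarz)
    also have "\<dots> \<le> bnorm B x * (?N * bnorm B x)"
      by (intro mult_left_mono bnorm_mult_le bnorm_nonneg)
    also have "\<dots> = (sqrt ?N * bnorm B x)\<^sup>2"
      by (simp add: power_mult_distrib mat_bnorm_nonneg) (simp add: power2_eq_square)
    finally show "bnorm B (C *v x) \<le> sqrt ?N * bnorm B x"
      by (rule power2_le_imp_le) (simp add: mat_bnorm_nonneg bnorm_nonneg)
  qed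
  then have "(mat_bnorm B C)\<^sup>2 \<le> (sqrt ?N)\<^sup>2"
    by (rule power_mono) (rule mat_bnorm_nonneg)
  then show "(mat_bnorm B C)\<^sup>2 \<le> ?N"
    by (simp add: mat_bnorm_nonneg)
qed

section \<open>Eigenvalues of a compression\<close>

text \<open>Let \<open>m\<close> be the minimum of the Rayleigh quotient of \<open>X\<close> over the range of \<open>Q\<close>, attained at \<open>v\<close>.
  Then \<open>H = Q (X - m) Q\<close> is positive semidefinite on the whole space and its form vanishes at
  \<open>v\<close>, so \<open>H v = 0\<close>, which is the eigenvalue equation.\<close>

lemma Rayleigh_minimizer_eigenvector:
  assumes X: "b_orthogonal B X" and Q: "b_orthogonal B Q" "Q ** Q = Q" "Q \<noteq> 0"
  obtains m v where "v \<noteq> 0" "Q *v v = v" "Q *v (X *v v) = of_real m *s v"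
    and "\<And>w. Q *v w = w \<Longrightarrow> m * Re (bform B w w) \<le> Re (bform B w (X *v w))"
proof -
  let ?S = "{x. Q *v x = x}"
  let ?q = "\<lambda>x. Re (bform B x (X *v x)) / Re (bform B x x)"
  have QQ: "Q *v (Q *v x) = Q *v x" for x
    by (simp add: matrix_vector_mul_assoc Q)
  obtain y where y: "Q *v y \<noteq> 0"
    using Q(3) by (metis matrix_eq matrix_vector_mult_0)
  have closed: "closed ?S"
    by (intro closed_Collect_eq linear_continuous_on[OF matrix_vector_mul_bounded_linear] continuous_on_id)
  have mem: "Q *v y \<in> ?S"
    by (simp add: QQ)
  have cone: "c *\<^sub>R x \<in> ?S" if "x \<in> ?S" for c x
    using that by (simp add: linear_cmul[OF matrix_vector_mul_linear])
  have cont: "continuous_on {x. x \<noteq> 0} ?q"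
    using continuous_on_bform[where C = "mat 1" and D = X]
      continuous_on_bform[where C = "mat 1" and D = "mat 1"]
    by (intro continuous_intros) (auto dest: bform_self_eq_0)
  have homog: "?q (c *\<^sub>R x) = ?q x" if "c \<noteq> 0" "x \<noteq> 0" for c x
    using that by (simp add: linear_cmul[OF matrix_vector_mul_linear] bform_linear_left bform_linear_right)
  obtain v where v: "v \<in> ?S" "v \<noteq> 0" "\<And>x. x \<in> ?S \<Longrightarrow> x \<noteq> 0 \<Longrightarrow> ?q v \<le> ?q x"
    by (rule homogeneous_attains_inf[of ?S "Q *v y" ?q, OF closed mem y cone cont homog])
      (assumption+, rule that)
  define m where "m = ?q v"
  have min: "m * Re (bform B w w) \<le> Re (bform B w (X *v w))" if "Q *v w = w" for w
  proof (cases "w = 0")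
    case False
    then show ?thesis
      using v(3)[of w] that bform_pos[of w] by (simp add: m_def pos_le_divide_eq)
  qed (simp add: bform_linear_left)
  define H where "H = Q ** (X - mat (of_real m)) ** Q"
  have Hv: "H *v x = Q *v (X *v (Q *v x)) - of_real m *s (Q *v x)" for x
    by (simp add: H_def matrix_vector_mult_diff_rdistrib matrix_vector_mult_diff_distrib
        mat_scalar_mult vector_scalar_commute QQ flip: matrix_vector_mul_assoc)
  have "badjoint B (mat (of_real m)) = mat (of_real m)"
    by (rule badjoint_eqI) (simp add: mat_scalar_mult bform_linear_left bform_linear_right)
  then have "b_orthogonal B H"
    using X Q(1) by (simp add: H_def b_orthogonal_def badjoint_mult badjoint_diff badjoint_one matrix_mul_assoc)
  moreover have H_form: "bform B x (H *v x) = bform B (Q *v x) (X *v (Q *v x)) - m * bform B (Q *v x) (Q *v x)" for x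
    using bform_badjoint_left[of Q x] Q(1)
    by (simp add: Hv bform_linear_right b_orthogonal_def QQ)
  moreover have "0 \<le> Re (bform B x (H *v x))" for x
    using min[of "Q *v x"] by (simp add: H_form QQ)
  moreover have "Re (bform B v (H *v v)) = 0"
    using v(1,2) bform_pos[of v] by (simp add: H_form m_def)
  ultimately have "H *v v = 0"
    using semidefinite_isotropic_in_kernel by blast
  then show ?thesis
    using that[of v m] v(1,2) min by (simp add: Hv)
qed

lemma selfadjoint_form_real:
  assumes "b_orthogonal B X"
  shows "bform B x (X *v x) = of_real (Re (bform B x (X *v x)))"
proof -
  have "bform B x (X *v x) = cnj (bform B x (X *v x))"
    using bform_badjoint_left[of X x x] bform_hermitian[of "X *v x" x] assms
    by (simp add: b_orthogonal_def)
  then show ?thesis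
    by (simp add: complex_eq_iff)
qed

text \<open>Eigenvectors for nonzero eigenvalues are carried over by \<open>Q\<close> in one direction and by \<open>X\<close> in the
  other: \<open>v\<close> goes to \<open>Q v\<close> and \<open>w\<close> to \<open>X w\<close>. Neither image vanishes when \<open>l \<noteq> 0\<close>.\<close>

lemma spectrum_mult_projection:
  assumes "Q ** Q = Q" "l \<noteq> 0"
  shows "l \<in> spectrum (X ** Q) \<longleftrightarrow> (\<exists>w. w \<noteq> 0 \<and> Q *v w = w \<and> Q *v (X *v w) = l *s w)"
proof
  have QQ: "Q *v (Q *v x) = Q *v x" for x
    by (simp add: matrix_vector_mul_assoc assms)
  assume "l \<in> spectrum (X ** Q)"
  then obtain v where v: "v \<noteq> 0" "X *v (Q *v v) = l *s v"
    by (auto simp: spectrum_def simp flip: matrix_vector_mul_assoc)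
  have "Q *v v \<noteq> 0"
    using v assms(2) by (auto simp: vector_mul_eq_0)
  moreover have "Q *v (X *v (Q *v v)) = l *s (Q *v v)"
    by (simp add: v(2) vector_scalar_commute)
  ultimately show "\<exists>w. w \<noteq> 0 \<and> Q *v w = w \<and> Q *v (X *v w) = l *s w"
    using QQ by blast
next
  assume "\<exists>w. w \<noteq> 0 \<and> Q *v w = w \<and> Q *v (X *v w) = l *s w"
  then obtain w where w: "w \<noteq> 0" "Q *v w = w" "Q *v (X *v w) = l *s w"
    by blast
  have "X *v w \<noteq> 0"
    using w assms(2) by (auto simp: vector_mul_eq_0)
  moreover have "(X ** Q) *v (X *v w) = l *s (X *v w)"
    by (simp add: w(3) vector_scalar_commute flip: matrix_vector_mul_assoc)
  ultimately show "l \<in> spectrum (X ** Q)"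
    by (auto simp: spectrum_def)
qed

section \<open>Two-grid error propagation\<close>

text \<open>The convergence estimate for an abstract smoother \<open>G\<close> and a \<open>B\<close>-orthogonal projection \<open>Q\<close>. All
  three conclusions concern the minimum \<open>m\<close> of the Rayleigh quotient of \<open>X\<close> on the range of \<open>Q\<close>:
  the norm because \<open>\<parallel>G\<^sup>+ w\<parallel>\<^sup>2 = \<langle>w, w\<rangle> - \<langle>w, X w\<rangle>\<close>, the spectrum because every nonzero eigenvalue
  is a value of this quotient.\<close>

lemma projected_smoother_spectrum:
  fixes G Q :: "complex ^ 'n ^ 'n"
  defines "X \<equiv> mat 1 - G ** badjoint B G"
  assumes contr: "mat_bnorm B G < 1" and inv: "invertible (G ** badjoint B G)"
    and Q: "b_orthogonal B Q" "Q ** Q = Q" "Q \<noteq> 0"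
  shows "(mat_bnorm B (badjoint B G ** Q))\<^sup>2 = 1 - lambda_min_pos (X ** Q)"
    and "lambda_min_pos (X ** Q) \<in> {0<..<1}"
    and "spectrum (X ** Q) \<subseteq> complex_of_real ` {0..<1}"
proof -
  let ?G' = "badjoint B G"
  have X: "b_orthogonal B X"
    by (simp add: X_def b_orthogonal_def badjoint_diff badjoint_one badjoint_mult badjoint_badjoint)
  have X_form: "Re (bform B w (X *v w)) = (bnorm B w)\<^sup>2 - (bnorm B (?G' *v w))\<^sup>2" for w
    using bform_badjoint_left[of G w "?G' *v w"]
    by (simp add: X_def matrix_vector_mult_diff_rdistrib bform_linear_right bnorm_sq
        flip: matrix_vector_mul_assoc)
  have X_pos: "0 < Re (bform B w (X *v w))" if "w \<noteq> 0" for w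
  proof -
    have "bnorm B (?G' *v w) \<le> mat_bnorm B G * bnorm B w"
      using bnorm_mult_le[of ?G' w] by (simp add: mat_bnorm_badjoint)
    also have "\<dots> < bnorm B w"
      using contr bnorm_pos[OF that] by simp
    finally show ?thesis
      using bnorm_nonneg power_strict_mono[of "bnorm B (?G' *v w)" "bnorm B w" 2]
      by (simp add: X_form)
  qed
  have X_less: "Re (bform B w (X *v w)) < Re (bform B w w)" if "w \<noteq> 0" for w
  proof -
    have "?G' *v w \<noteq> 0"
      using invertible_kernel_zero[OF inv, of w] that by (auto simp flip: matrix_vector_mul_assoc)
    then show ?thesis
      using bform_pos by (simp add: X_form bnorm_sq)
  qed
  obtain m v where v: "v \<noteq> 0" "Q *v v = v" "Q *v (X *v v) = of_real m *s v"
    and min: "\<And>w. Q *v w = w \<Longrightarrow> m * Re (bform B w w) \<le> Re (bform B w (X *v w))"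
    using Rayleigh_minimizer_eigenvector[OF X Q] by blast
  have eigenvalue: "bform B w (X *v w) = l * bform B w w" if "Q *v w = w" "Q *v (X *v w) = l *s w" for w l
  proof -
    have "bform B w (X *v w) = bform B w (Q *v (X *v w))"
      using bform_badjoint_left[of Q w "X *v w"] Q(1) that(1) by (simp add: b_orthogonal_def)
    then show ?thesis
      by (simp add: that(2) bform_linear_right)
  qed
  have Xv: "Re (bform B v (X *v v)) = m * Re (bform B v v)"
    using eigenvalue[OF v(2,3)] by simp
  have m: "0 < m" "m < 1"
    using X_pos[OF v(1)] X_less[OF v(1)] bform_pos[OF v(1)] by (auto simp: Xv zero_less_mult_iff)
  have range: "\<exists>r. l = of_real r \<and> m \<le> r \<and> r < 1" if l: "l \<in> spectrum (X ** Q)" "l \<noteq> 0" for l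
  proof -
    obtain w where w: "w \<noteq> 0" "Q *v w = w" "Q *v (X *v w) = l *s w"
      using l(1) unfolding spectrum_mult_projection[OF Q(2) l(2)] by blast
    define r where "r = Re (bform B w (X *v w)) / Re (bform B w w)"
    have pos: "0 < Re (bform B w w)"
      using w(1) by (rule bform_pos)
    have "of_real (Re (bform B w (X *v w))) = l * of_real (Re (bform B w w))"
      using eigenvalue[OF w(2,3)] selfadjoint_form_real[OF X, of w] bform_self_real[of w] by simp
    then have "l = of_real r"
      using pos by (simp add: r_def field_simps)
    moreover have "m \<le> r" "r < 1"
      using min[OF w(2)] X_less[OF w(1)] pos by (simp_all add: r_def field_simps)
    ultimately show ?thesis by blast
  qed
  have "of_real m \<in> spectrum (X ** Q)"
    using v m spectrum_mult_projection[OF Q(2), of "of_real m" X] by auto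
  then have lambda: "lambda_min_pos (X ** Q) = m"
    unfolding lambda_min_pos_def using m range by (intro Least_equality) fastforce+
  then show "lambda_min_pos (X ** Q) \<in> {0<..<1}"
    using m by simp
  show "spectrum (X ** Q) \<subseteq> complex_of_real ` {0..<1}"
  proof
    fix l assume l: "l \<in> spectrum (X ** Q)"
    show "l \<in> complex_of_real ` {0..<1}"
    proof (cases "l = 0")
      case True
      then show ?thesis by (intro image_eqI[of _ _ 0]) auto
    next
      case False
      then show ?thesis using range[OF l] m by fastforce
    qed
  qed
  \<comment> \<open>the bound uses that Q does not increase the norm; the minimiser v attains it\<close>
  have "mat_bnorm B (?G' ** Q) \<le> sqrt (1 - m)"
  proof (rule mat_bnorm_le)
    fix x
    let ?w = "Q *v x"
    have w: "Q *v ?w = ?w"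
      by (simp add: matrix_vector_mul_assoc Q)
    have "(bnorm B ?w)\<^sup>2 = Re (bform B x ?w)"
      using bform_badjoint_left[of Q x ?w] Q(1) w by (simp add: bnorm_sq b_orthogonal_def)
    then have "(bnorm B ?w)\<^sup>2 \<le> bnorm B x * bnorm B ?w"
      using bform_Cauchy_Schwarz[of x ?w] by simp
    then have w_le: "bnorm B ?w \<le> bnorm B x"
      using bnorm_le_of_sq bnorm_nonneg by blast
    have "(bnorm B ((?G' ** Q) *v x))\<^sup>2 = (bnorm B ?w)\<^sup>2 - Re (bform B ?w (X *v ?w))"
      by (simp add: X_form flip: matrix_vector_mul_assoc)
    also have "\<dots> \<le> (1 - m) * (bnorm B ?w)\<^sup>2"
      using min[OF w] by (simp add: bnorm_sq algebra_simps)
    also have "\<dots> \<le> (1 - m) * (bnorm B x)\<^sup>2"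
      using m w_le bnorm_nonneg by (intro mult_left_mono power_mono) auto
    also have "\<dots> = (sqrt (1 - m) * bnorm B x)\<^sup>2"
      using m by (simp add: power_mult_distrib)
    finally show "bnorm B ((?G' ** Q) *v x) \<le> sqrt (1 - m) * bnorm B x"
      by (rule power2_le_imp_le) (use m bnorm_nonneg in simp)
  qed
  then have "(mat_bnorm B (?G' ** Q))\<^sup>2 \<le> (sqrt (1 - m))\<^sup>2"
    by (rule power_mono) (rule mat_bnorm_nonneg)
  moreover have "1 - m \<le> (mat_bnorm B (?G' ** Q))\<^sup>2"
  proof -
    have "(1 - m) * (bnorm B v)\<^sup>2 = (bnorm B ((?G' ** Q) *v v))\<^sup>2"
      using X_form[of v] by (simp add: Xv v(2) bnorm_sq algebra_simps flip: matrix_vector_mul_assoc)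
    also have "\<dots> \<le> (mat_bnorm B (?G' ** Q) * bnorm B v)\<^sup>2"
      by (intro power_mono bnorm_mult_le bnorm_nonneg)
    finally show ?thesis
      using bnorm_pos[OF v(1)] by (simp add: power_mult_distrib)
  qed
  ultimately show "(mat_bnorm B (?G' ** Q))\<^sup>2 = 1 - lambda_min_pos (X ** Q)"
    using m by (simp add: lambda)
qed

text \<open>With \<open>K = M\<^sup>-\<^sup>1 A\<close>, both sides equal \<open>K + K\<^sup>+ - K K\<^sup>+\<close>.\<close>

lemma Mhat_inv_smoother:
  fixes A M :: "complex ^ 'n ^ 'n"
  defines "G \<equiv> mat 1 - matrix_inv M ** A"
  shows "Mhat_inv A M B ** B = mat 1 - G ** badjoint B G"
proof -
  define K where "K = matrix_inv M ** A"
  have "Mhat_inv A M B ** B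
    = K ** (matrix_inv B ** B) + badjoint B K - K ** badjoint B K"
    by (simp add: Mhat_inv_def K_def badjoint_def adjoint_mat_mult matrix_mul_assoc
        matrix_add_rdistrib matrix_sub_rdistrib)
  then show ?thesis
    by (simp add: G_def matrix_inv_inverts[OF hpd_invertible] badjoint_diff badjoint_one
        matrix_sub_ldistrib matrix_sub_rdistrib flip: K_def)
qed

end

theorem theorem3p16:
  fixes A M B :: "complex ^ 'n ^ 'n"
    and P R :: "complex ^ 'c ^ 'n"
  assumes "invertible A"
    and "invertible M"
    and "hpd B"
    and "CARD('c) < CARD('n)"
    and "invertible (R\<^sup>H ** A ** P)"
    and "mat_bnorm B (mat 1 - matrix_inv M ** A) < 1"
    and "coarse_proj A P R ** coarse_proj A P R = coarse_proj A P R"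
    and "b_orthogonal B (coarse_proj A P R)"
    and "coarse_proj A P R \<noteq> 0"
    and "coarse_proj A P R \<noteq> mat 1"
    and "invertible (mat 1 - Mhat_inv A M B ** B)"
  shows "mat_bnorm B (error_prop A M B P R 1 1) = (mat_bnorm B (error_prop A M B P R 1 0))\<^sup>2
    \<and> (mat_bnorm B (error_prop A M B P R 1 0))\<^sup>2 = (mat_bnorm B (error_prop A M B P R 0 1))\<^sup>2
    \<and> (mat_bnorm B (error_prop A M B P R 0 1))\<^sup>2
        = 1 - lambda_min_pos (Mhat_inv A M B ** B ** (mat 1 - coarse_proj A P R))
    \<and> lambda_min_pos (Mhat_inv A M B ** B ** (mat 1 - coarse_proj A P R)) \<in> {0<..<1}
    \<and> spectrum (Mhat_inv A M B ** B ** (mat 1 - coarse_proj A P R))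
        \<subseteq> complex_of_real ` {0..<1}"
proof -
  define G where "G = mat 1 - matrix_inv M ** A"
  define Q where "Q = mat 1 - coarse_proj A P R"
  note B = \<open>hpd B\<close>
  have Q: "b_orthogonal B Q" "Q ** Q = Q" "Q \<noteq> 0"
    using assms(7,8,10)
    by (simp_all add: Q_def b_orthogonal_def badjoint_diff[OF B] badjoint_one[OF B]
        matrix_sub_ldistrib matrix_sub_rdistrib)
  have smoother_adjoint: "mat 1 - badjoint B (matrix_inv M ** A) = badjoint B G"
    by (simp add: G_def badjoint_diff[OF B] badjoint_one[OF B])
  have E10: "error_prop A M B P R 1 0 = Q ** G"
    and E01: "error_prop A M B P R 0 1 = badjoint B G ** Q"
    and E11: "error_prop A M B P R 1 1 = badjoint B G ** Q ** G"
    by (simp_all add: error_prop_def smoother_adjoint flip: G_def Q_def)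
  have adj: "badjoint B (Q ** G) = badjoint B G ** Q"
    using Q(1) by (simp add: badjoint_mult[OF B] b_orthogonal_def)
  have "badjoint B G ** Q ** G = badjoint B (Q ** G) ** (Q ** G)"
    by (metis adj Q(2) matrix_mul_assoc)
  then have "mat_bnorm B (error_prop A M B P R 1 1) = (mat_bnorm B (error_prop A M B P R 1 0))\<^sup>2"
    unfolding E10 E11 using mat_bnorm_badjoint_mult_self[OF B, of "Q ** G"] by simp
  moreover have "mat_bnorm B (error_prop A M B P R 1 0) = mat_bnorm B (error_prop A M B P R 0 1)"
    using mat_bnorm_badjoint[OF B, of "Q ** G"] unfolding E10 E01 by (simp add: adj)
  moreover have Mhat: "Mhat_inv A M B ** B = mat 1 - G ** badjoint B G"
    unfolding G_def by (rule Mhat_inv_smoother[OF B])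
  moreover have "invertible (G ** badjoint B G)"
    using assms(11) by (simp add: Mhat)
  ultimately show ?thesis
    using projected_smoother_spectrum[OF B, of G Q] assms(6) Q
    unfolding E01 by (simp flip: G_def Q_def)
qed

end
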